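(* Let $k\ge1$ and $0\le n,m\le k$. For generic parameters $\alpha,\beta,\gamma,\delta,\rho,\sigma$, $$R_n^m(\alpha,\beta,\gamma,\delta;k;q,p)=\sum_{l=0}^kR_n^l(\alpha,\beta,\rho,\sigma;k;q,p)\,R_l^m(\rho,\sigma,\gamma,\delta;k;q,p).$$
   Context: Fix $\tau\in\mathbb{C}$ with $\mathrm{Im}\,\tau>0$ and a nonzero parameter $r$; put $\tilde p=e^{2\pi i\tau}$, $x=e^{-\pi i/(r\tau)}$ (powers $x^s=e^{-\pi i s/(r\tau)}$), $q=-x$, $p=x^{2r}$ (the letters $q,p$ in $R_n^m$ only record these fixed parameters). Let $\vartheta_1(u|\tau)=2\tilde p^{1/8}(\tilde p;\tilde p)_\infty\sin\pi u\prod_{n\ge1}(1-2\tilde p^n\cos 2\pi u+\tilde p^{2n})$, $[u]=C\,\vartheta_1(\frac{u}{r}|\tau)$ with $C=x^{-r/4}e^{-\pi i/4}\tau^{1/2}$, and $[u]_n=\prod_{j=0}^{n-1}[u+j]$. Let $\Theta_k$ be the $(k+1)$-dimensional space of entire $f$ with $f(z+1)=f(z)$, $f(z+\tau)=e^{-2\pi ik(2z+\tau)}f(z)$, $f(-z)=f(z)$. For $0\le n\le k$ put $e^k_n(z;\alpha,\beta)=[\alpha+rz]_n[\alpha-rz]_n[\beta+rz]_{k-n}[\beta-rz]_{k-n}\in\Theta_k$. These form a basis of $\Theta_k$ (natural basis) if $$\tfrac{\alpha-\beta+j}{r}\notin\mathbb{Z}+\tau\mathbb{Z}\ (j=1-k,\dots,k-1),\qquad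 \tfrac{\alpha+\beta+j}{r}\notin\mathbb{Z}+\tau\mathbb{Z}\ (j=0,\dots,k-1).$$ The elliptic $6j$-symbols $R_n^m$ are defined by $$e^k_n(z;\alpha,\beta)=\sum_{m=0}^kR_n^m(\alpha,\beta,\gamma,\delta;k;q,p)\,e^k_m(z;\gamma,\delta).$$ "Generic" means that each of the pairs $(\alpha,\beta)$, $(\rho,\sigma)$, $(\gamma,\delta)$ satisfies the basis conditions above. *)

theory Defs
  imports "HOL-Analysis.Analysis"
begin

text \<open>The parameters \<open>\<tau>\<close> (with \<open>Im \<tau> > 0\<close>) and \<open>r \<noteq> 0\<close>, which the informal
  notation keeps fixed, are explicit arguments below.  They replace the letters \<open>q\<close>, \<open>p\<close>
  in the notation for the \<open>6j\<close>-symbols.\<close>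

definition nome :: "complex \<Rightarrow> complex" where
  "nome \<tau> = exp (2 * of_real pi * \<i> * \<tau>)"

text \<open>\<open>nome \<tau> powr (1/8)\<close> would use the principal branch of the logarithm; the eighth
  root intended here is \<open>exp (2 \<pi> i \<tau> / 8)\<close>.\<close>

definition theta1 :: "complex \<Rightarrow> complex \<Rightarrow> complex" where
  "theta1 u \<tau> =
     2 * exp (2 * of_real pi * \<i> * \<tau> / 8) * (\<Prod>j. 1 - nome \<tau> ^ Suc j)
       * sin (of_real pi * u)
       * (\<Prod>j. 1 - 2 * nome \<tau> ^ Suc j * cos (2 * of_real pi * u) + nome \<tau> ^ (2 * Suc j))"

text \<open>\<open>x_pow \<tau> r s\<close> is the power \<open>x\<^sup>s\<close> of \<open>x = exp (- \<pi> i / (r \<tau>))\<close>, with the branch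
  fixed as follows.\<close>

definition x_pow :: "complex \<Rightarrow> complex \<Rightarrow> complex \<Rightarrow> complex" where
  "x_pow \<tau> r s = exp (- (of_real pi * \<i> * s / (r * \<tau>)))"

definition bracket_const :: "complex \<Rightarrow> complex \<Rightarrow> complex" where
  "bracket_const \<tau> r = x_pow \<tau> r (- r / 4) * exp (- (of_real pi * \<i> / 4)) * csqrt \<tau>"

definition bracket :: "complex \<Rightarrow> complex \<Rightarrow> complex \<Rightarrow> complex" where
  "bracket \<tau> r u = bracket_const \<tau> r * theta1 (u / r) \<tau>"

definition bracket_poch :: "complex \<Rightarrow> complex \<Rightarrow> complex \<Rightarrow> nat \<Rightarrow> complex" where
  "bracket_poch \<tau> r u n = (\<Prod>j<n. bracket \<tau> r (u + of_nat j))"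

text \<open>The function \<open>e\<^sup>k\<^sub>n(z; \<alpha>, \<beta>)\<close>, for \<open>n \<le> k\<close>.\<close>

definition nat_basis ::
  "complex \<Rightarrow> complex \<Rightarrow> nat \<Rightarrow> nat \<Rightarrow> complex \<Rightarrow> complex \<Rightarrow> complex \<Rightarrow> complex" where
  "nat_basis \<tau> r k n \<alpha> \<beta> z =
     bracket_poch \<tau> r (\<alpha> + r * z) n * bracket_poch \<tau> r (\<alpha> - r * z) n
       * bracket_poch \<tau> r (\<beta> + r * z) (k - n) * bracket_poch \<tau> r (\<beta> - r * z) (k - n)"

definition period_lattice :: "complex \<Rightarrow> complex set" where
  "period_lattice \<tau> = {of_int a + of_int b * \<tau> | a b. True}"

definition generic_pair ::
  "complex \<Rightarrow> complex \<Rightarrow> nat \<Rightarrow> complex \<Rightarrow> complex \<Rightarrow> bool" where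
  "generic_pair \<tau> r k \<alpha> \<beta> \<longleftrightarrow>
     (\<forall>j \<in> {1 - int k .. int k - 1}. (\<alpha> - \<beta> + of_int j) / r \<notin> period_lattice \<tau>) \<and>
     (\<forall>j \<in> {0 .. int k - 1}. (\<alpha> + \<beta> + of_int j) / r \<notin> period_lattice \<tau>)"

text \<open>\<open>elliptic_6j \<tau> r k n m \<alpha> \<beta> \<gamma> \<delta>\<close> is \<open>R\<^sub>n\<^sup>m(\<alpha>, \<beta>, \<gamma>, \<delta>; k; q, p)\<close>, the coefficient
  of \<open>e\<^sup>k\<^sub>m(z; \<gamma>, \<delta>)\<close> in the expansion of \<open>e\<^sup>k\<^sub>n(z; \<alpha>, \<beta>)\<close>.  The condition \<open>c j = 0\<close> for
  \<open>j > k\<close> only normalizes the irrelevant values of the coefficient function, so that it is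
  unique exactly when the expansion exists and is unique (in particular when \<open>(\<gamma>, \<delta>)\<close> is
  a generic pair).\<close>

definition elliptic_6j ::
  "complex \<Rightarrow> complex \<Rightarrow> nat \<Rightarrow> nat \<Rightarrow> nat
     \<Rightarrow> complex \<Rightarrow> complex \<Rightarrow> complex \<Rightarrow> complex \<Rightarrow> complex" where
  "elliptic_6j \<tau> r k n m \<alpha> \<beta> \<gamma> \<delta> =
     (THE c :: nat \<Rightarrow> complex.
        (\<forall>j>k. c j = 0) \<and>
        (\<forall>z. nat_basis \<tau> r k n \<alpha> \<beta> z = (\<Sum>j\<le>k. c j * nat_basis \<tau> r k j \<gamma> \<delta> z))) m"

end

theory Submission
  imports Defs "HOL-Complex_Analysis.Cauchy_Integral_Formula" "Jordan_Normal_Form.Determinant"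
begin

text \<open>
  The identity is the composition law for changes of basis: expanding
  \<open>e\<^sub>n(z; \<alpha>, \<beta>)\<close> in the \<open>e\<^sub>l(z; \<rho>, \<sigma>)\<close> and these in the \<open>e\<^sub>m(z; \<gamma>, \<delta>)\<close> gives a second
  expansion of \<open>e\<^sub>n(z; \<alpha>, \<beta>)\<close> in the last family, and coefficients are unique.  The
  substance is that a natural basis really is one: every product of the same shape has exactly
  one expansion in it (\<open>nat_basis_expansion_exists\<close>, \<open>nat_basis_independent\<close>).

  The key observation is that \<open>[c + w] [c - w]\<close> is, up to a constant factor, a determinant
  \<open>u(c) v(w) - v(c) u(w)\<close>, so as a function of \<open>w\<close> it is a linear form in the two functions
  \<open>u\<close>, \<open>v\<close>.  Equivalently, these brackets satisfy the Pluecker relation for two-by-two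
  determinants, which is the three-term relation for theta functions (\<open>three_term\<close>).
  Each \<open>e\<^sub>n\<close> is thus a product of \<open>k\<close> linear forms in two variables, and the dimension \<open>k + 1\<close> of
  \<open>\<Theta>\<^sub>k\<close> is that of the binary forms of degree \<open>k\<close>.  The genericity conditions say precisely
  that the forms belonging to \<open>\<gamma> + i\<close> and \<open>\<delta> + j\<close> are linearly independent for \<open>i + j < k\<close>.

  Spanning (\<open>form_prod_in_span\<close>) is an induction on \<open>k\<close>: a new linear factor \<open>L\<close> is a
  combination of the next factor at \<open>\<gamma> + j\<close> and the next factor at \<open>\<delta> + (k - j)\<close>, so \<open>L\<close> times
  the \<open>j\<close>-th basis product is a combination of the products with indices \<open>j + 1\<close> and \<open>j\<close> in
  degree \<open>k + 1\<close>.  Independence (\<open>form_prods_independent\<close>) then follows by counting: choose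
  \<open>k + 1\<close> points such that no form attached to one of them vanishes at another.  The products
  that vanish at all but one of them are independent and lie in the span of \<open>k + 1\<close> functions.

  The three-term relation itself comes from Liouville's theorem: both sides are quasi-periodic
  with the same factors, so their difference divided by \<open>\<theta>(a + z) \<theta>(a - z)\<close> is an elliptic
  function without poles.  This needs the zeros of theta and that they are simple, which
  the infinite product provides.
\<close>

section \<open>Periods\<close>

lemma invariant_add_int_mult:
  fixes P :: "complex \<Rightarrow> bool"
  assumes "\<And>z. P (z + w) \<longleftrightarrow> P z"
  shows "P (z + of_int a * w) \<longleftrightarrow> P z"
proof (induction a rule: int_induct[where k = 0])
  case (step1 i)
  then show ?case using assms[of "z + of_int i * w"] by (simp add: algebra_simps)
next
  case (step2 i)
  then show ?case using assms[of "z + of_int (i - 1) * w"] by (simp add: algebra_simps)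
qed simp

text \<open>Stated for predicates, so that it transports vanishing, simplicity of zeros and bounds alike
  from one point to all its translates.\<close>

lemma period_lattice_invariant:
  fixes P :: "complex \<Rightarrow> bool"
  assumes "\<And>z. P (z + 1) \<longleftrightarrow> P z" and "\<And>z. P (z + \<tau>) \<longleftrightarrow> P z" and "l \<in> period_lattice \<tau>"
  shows "P (z + l) \<longleftrightarrow> P z"
proof -
  obtain a b where l: "l = of_int a + of_int b * \<tau>"
    using assms(3) by (auto simp: period_lattice_def)
  have "P ((z + of_int a * 1) + of_int b * \<tau>) \<longleftrightarrow> P z"
    using invariant_add_int_mult[of P, OF assms(1)] invariant_add_int_mult[of P, OF assms(2)] by blast
  then show ?thesis by (simp add: l add.assoc)
qed

section \<open>Analytic properties of the theta function\<close>

text \<open>The q-Pochhammer symbol \<open>(p w; p)\<^sub>\<infinity>\<close>.\<close>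

definition q_prod :: "complex \<Rightarrow> complex \<Rightarrow> complex" where
  "q_prod p w = (\<Prod>j. 1 - p ^ Suc j * w)"

lemma convergent_q_prod:
  assumes "norm p < 1"
  shows "convergent_prod (\<lambda>j. 1 - p ^ Suc j * (w::complex))"
proof -
  have "summable (\<lambda>j. norm w * norm p * norm p ^ j)"
    by (intro summable_mult summable_geometric) (use assms in auto)
  then have "summable (\<lambda>j. norm ((1 - p ^ Suc j * w) - 1))"
    by (simp add: norm_mult norm_power mult_ac)
  then show ?thesis
    by (intro abs_convergent_prod_imp_convergent_prod summable_imp_abs_convergent_prod)
qed

lemma q_prod_has_prod:
  assumes "norm p < 1"
  shows "(\<lambda>j. 1 - p ^ Suc j * w) has_prod q_prod p w"
  unfolding q_prod_def by (rule convergent_prod_has_prod[OF convergent_q_prod[OF assms]])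

lemma q_prod_eq_0_iff:
  assumes "norm p < 1"
  shows "q_prod p w = 0 \<longleftrightarrow> (\<exists>j. p ^ Suc j * w = 1)"
  using has_prod_eq_0_iff[OF q_prod_has_prod[OF assms, of w]]
  by (auto simp: image_iff)

lemma q_prod_1_nonzero:
  assumes "norm p < 1"
  shows "q_prod p 1 \<noteq> 0"
proof
  assume "q_prod p 1 = 0"
  then obtain j where "p ^ Suc j = 1"
    by (auto simp: q_prod_eq_0_iff[OF assms])
  then have "norm p ^ Suc j = 1"
    by (metis norm_one norm_power)
  moreover have "norm p ^ Suc j < 1"
    using assms by (simp only: power_less_one_iff norm_ge_zero) simp
  ultimately show False by simp
qed

lemma q_prod_shift:
  assumes "norm p < 1"
  shows "q_prod p w = (1 - p * w) * q_prod p (p * w)"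
proof -
  have "(\<lambda>j. 1 - p ^ Suc (Suc j) * w) has_prod q_prod p (p * w)"
    using q_prod_has_prod[OF assms, of "p * w"] by (simp add: mult_ac)
  from has_prod_Suc_imp[OF this]
  have "(\<lambda>j. 1 - p ^ Suc j * w) has_prod (q_prod p (p * w) * (1 - p * w))"
    by simp
  then show ?thesis
    using has_prod_unique2[OF q_prod_has_prod[OF assms, of w]] by (simp add: mult.commute)
qed

lemma holomorphic_q_prod:
  assumes "norm p < 1"
  shows "q_prod p holomorphic_on UNIV"
proof (rule holomorphic_uniform_sequence)
  show "(\<lambda>w. \<Prod>j<n. 1 - p ^ Suc j * w) holomorphic_on UNIV" for n
    by (intro holomorphic_intros)
next
  fix w :: complex
  let ?P = "\<lambda>n w. \<Prod>j<n. 1 - p ^ Suc j * w"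
  have "uniformly_convergent_on (cball w 1) ?P"
  proof (rule uniformly_convergent_on_prod')
    show "uniformly_convergent_on (cball w 1) (\<lambda>N x. \<Sum>n<N. norm (1 - p ^ Suc n * x - 1))"
    proof (rule Weierstrass_m_test')
      fix n x assume "x \<in> cball w 1"
      then have "norm x \<le> norm w + 1"
        using norm_triangle_ineq2[of x w] by (simp add: dist_norm norm_minus_commute)
      then show "norm (norm (1 - p ^ Suc n * x - 1)) \<le> ((norm w + 1) * norm p) * norm p ^ n"
        by (auto simp: norm_mult norm_power mult_ac intro!: mult_left_mono mult_right_mono)
    next
      show "summable (\<lambda>n. ((norm w + 1) * norm p) * norm p ^ n)"
        by (intro summable_mult summable_geometric) (use assms in auto)
    qed
  qed (auto intro!: continuous_intros)
  then obtain g where g: "uniform_limit (cball w 1) ?P g sequentially"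
    by (auto simp: uniformly_convergent_on_def)
  also have "?this \<longleftrightarrow> uniform_limit (cball w 1) ?P (q_prod p) sequentially"
  proof (intro uniform_limit_cong)
    fix z assume "z \<in> cball w 1"
    with g have "(\<lambda>n. ?P n z) \<longlonglongrightarrow> g z"
      by (rule tendsto_uniform_limitI)
    moreover have "(\<lambda>n. ?P n z) \<longlonglongrightarrow> q_prod p z"
      by (rule has_prod_imp_tendsto'[OF q_prod_has_prod[OF assms]])
    ultimately show "g z = q_prod p z"
      using LIMSEQ_unique by blast
  qed auto
  finally show "\<exists>d>0. cball w d \<subseteq> UNIV \<and> uniform_limit (cball w d) ?P (q_prod p) sequentially"
    by (intro exI[of _ 1]) auto
qed auto

lemma holomorphic_q_prod_compose:
  assumes "norm p < 1" and "f holomorphic_on A"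
  shows "(\<lambda>u. q_prod p (f u)) holomorphic_on A"
  using holomorphic_on_compose_gen[OF assms(2) holomorphic_q_prod[OF assms(1)]]
  by (simp add: o_def)

lemma norm_nome_less_1:
  assumes "Im \<tau> > 0"
  shows "norm (nome \<tau>) < 1"
  using assms by (simp add: nome_def)

text \<open>The quadratic factors split as \<open>(1 - p\<^sup>j w) (1 - p\<^sup>j / w)\<close> with \<open>w = exp (2 \<pi> i u)\<close>.  In this form
  the translation by \<open>\<tau>\<close> is an index shift and the zeros can be read off.\<close>

lemma theta1_product:
  assumes "Im \<tau> > 0"
  obtains K where "K \<noteq> 0"
    and "\<And>u. theta1 u \<tau> = K * sin (of_real pi * u)
           * q_prod (nome \<tau>) (exp (2 * of_real pi * \<i> * u))
           * q_prod (nome \<tau>) (exp (-(2 * of_real pi * \<i> * u)))"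
proof
  note n1 = norm_nome_less_1[OF assms]
  let ?K = "2 * exp (2 * of_real pi * \<i> * \<tau> / 8) * q_prod (nome \<tau>) 1"
  show "?K \<noteq> 0" using q_prod_1_nonzero[OF n1] by simp
  fix u
  let ?w = "exp (2 * of_real pi * \<i> * u)"
  let ?v = "exp (-(2 * of_real pi * \<i> * u))"
  have wv: "?w * ?v = 1" by (simp add: exp_minus)
  have cosu: "2 * cos (2 * of_real pi * u) = ?w + ?v"
    by (simp add: cos_exp_eq mult_ac)
  have factor: "1 - 2 * N * c + N * N = (1 - N * a) * (1 - N * b)"
    if "a * b = 1" "2 * c = a + b" for N a b c :: complex
  proof -
    have "(1 - N * a) * (1 - N * b) = 1 - N * (a + b) + N * N * (a * b)"
      by (simp add: algebra_simps)
    then show ?thesis by (simp add: that(1) that(2)[symmetric])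
  qed
  have "1 - 2 * nome \<tau> ^ Suc j * cos (2 * of_real pi * u) + nome \<tau> ^ (2 * Suc j)
       = (1 - nome \<tau> ^ Suc j * ?w) * (1 - nome \<tau> ^ Suc j * ?v)" for j
    using factor[OF wv cosu, of "nome \<tau> ^ Suc j"] unfolding power_add[symmetric] mult_2[symmetric] .
  then have "(\<Prod>j. 1 - 2 * nome \<tau> ^ Suc j * cos (2 * of_real pi * u) + nome \<tau> ^ (2 * Suc j))
      = q_prod (nome \<tau>) ?w * q_prod (nome \<tau>) ?v"
    unfolding q_prod_def by (simp only: prodinf_mult convergent_q_prod[OF n1])
  then show "theta1 u \<tau> = ?K * sin (of_real pi * u) * q_prod (nome \<tau>) ?w * q_prod (nome \<tau>) ?v"
    unfolding theta1_def by (simp add: q_prod_def)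
qed

lemma theta1_minus: "theta1 (-u) \<tau> = - theta1 u \<tau>"
  by (simp add: theta1_def)

lemma holomorphic_theta1:
  assumes "Im \<tau> > 0"
  shows "(\<lambda>u. theta1 u \<tau>) holomorphic_on UNIV"
proof -
  obtain K where K: "\<And>u. theta1 u \<tau> = K * sin (of_real pi * u)
           * q_prod (nome \<tau>) (exp (2 * of_real pi * \<i> * u))
           * q_prod (nome \<tau>) (exp (-(2 * of_real pi * \<i> * u)))"
    using theta1_product[OF assms] by metis
  show ?thesis
    unfolding K by (intro holomorphic_intros holomorphic_q_prod_compose norm_nome_less_1 assms)
qed

lemma theta1_add_1: "theta1 (u + 1) \<tau> = - theta1 u \<tau>"
proof -
  have "sin (of_real pi * (u + 1)) = - sin (of_real pi * u)"
    by (simp add: ring_distribs sin_add sin_of_real cos_of_real)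
  moreover have "cos (2 * of_real pi * (u + 1)) = cos (2 * of_real pi * u)"
    using cos_of_real[of "2*pi"] sin_of_real[of "2*pi"]
    by (simp add: ring_distribs cos_add)
  ultimately show ?thesis
    by (simp add: theta1_def)
qed

text \<open>The translation replaces \<open>w\<close> by \<open>p w\<close>: one product loses its first factor \<open>1 - p w\<close>, the other
  gains the factor \<open>1 - 1 / w\<close>, and the sine exchanges the two up to the stated exponential.\<close>

lemma theta1_add_tau:
  assumes "Im \<tau> > 0"
  shows "theta1 (u + \<tau>) \<tau> = - exp (-(of_real pi * \<i> * (2 * u + \<tau>))) * theta1 u \<tau>"
proof -
  obtain K where K: "\<And>u. theta1 u \<tau> = K * sin (of_real pi * u)
           * q_prod (nome \<tau>) (exp (2 * of_real pi * \<i> * u))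
           * q_prod (nome \<tau>) (exp (-(2 * of_real pi * \<i> * u)))"
    using theta1_product[OF assms] by metis
  note n1 = norm_nome_less_1[OF assms]
  \<comment> \<open>In terms of \<open>s\<close> and \<open>t\<close>, square roots of \<open>w\<close> and of the nome, all factors are rational.\<close>
  define s where "s = exp (of_real pi * \<i> * u)"
  define t where "t = exp (of_real pi * \<i> * \<tau>)"
  have nz: "s \<noteq> 0" "t \<noteq> 0" by (auto simp: s_def t_def)
  have dbl: "exp (2 * of_real pi * \<i> * z) = exp (of_real pi * \<i> * z) ^ 2" for z
    by (simp add: exp_double[symmetric] mult_ac)
  have p: "nome \<tau> = t^2" unfolding nome_def t_def by (rule dbl)
  have eu: "exp (2 * of_real pi * \<i> * u) = s^2" "exp (-(2 * of_real pi * \<i> * u)) = 1/s^2"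
    unfolding exp_minus dbl s_def by (simp_all add: field_simps)
  have st: "exp (of_real pi * \<i> * (u + \<tau>)) = s * t"
    by (simp add: s_def t_def exp_add ring_distribs)
  have et: "exp (2 * of_real pi * \<i> * (u + \<tau>)) = (s*t)^2"
    "exp (-(2 * of_real pi * \<i> * (u + \<tau>))) = 1/(s*t)^2"
    unfolding exp_minus dbl st by (simp_all add: field_simps)
  have sn: "sin (of_real pi * z) = (y - 1/y) / (2*\<i>)" if "exp (of_real pi * \<i> * z) = y" for z y
    using that by (simp add: sin_exp_eq exp_minus mult_ac field_simps)
  have s1: "sin (of_real pi * u) = (s - 1/s) / (2*\<i>)"
    by (rule sn) (simp add: s_def)
  have s2: "sin (of_real pi * (u+\<tau>)) = (s*t - 1/(s*t)) / (2*\<i>)"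
    by (rule sn) (rule st)
  have e: "exp (-(of_real pi * \<i> * (2 * u + \<tau>))) = 1 / (s^2 * t)"
  proof -
    have "exp (of_real pi * \<i> * (2 * u + \<tau>)) = s^2 * t"
      unfolding s_def t_def exp_double[symmetric] exp_add[symmetric] by (simp add: algebra_simps)
    then show ?thesis unfolding exp_minus by (simp add: divide_inverse)
  qed
  define A where "A = q_prod (nome \<tau>) ((s*t)^2)"
  define B where "B = q_prod (nome \<tau>) (1/s^2)"
  have A: "q_prod (nome \<tau>) (s^2) = (1 - (s*t)^2) * A"
    using q_prod_shift[OF n1, of "s^2"] by (simp add: A_def p power_mult_distrib mult_ac)
  have B: "q_prod (nome \<tau>) (1/(s*t)^2) = (1 - 1/s^2) * B"
    using q_prod_shift[OF n1, of "1/(s*t)^2"] nz by (simp add: B_def p power_mult_distrib mult_ac)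
  have rearrange: "K * (x1 / (2*\<i>)) * A * (x2 * B) = - e * (K * (x3 / (2*\<i>)) * (x4 * A) * B)"
    if "x1 * x2 = - e * (x3 * x4)" for x1 x2 x3 x4 e
    using arg_cong[OF that, of "\<lambda>x. x * (K * A * B / (2*\<i>))"] by (simp add: algebra_simps)
  have "(s*t - 1/(s*t)) * (1 - 1/s^2) = - (1 / (s^2 * t)) * ((s - 1/s) * (1 - (s*t)^2))"
    using nz by (simp add: field_simps power2_eq_square)
  from rearrange[OF this] show ?thesis
    unfolding e K[of "u + \<tau>"] K[of u] et eu s1 s2 B unfolding A A_def[symmetric] B_def[symmetric] .
qed

lemma theta1_eq_0_iff:
  assumes "Im \<tau> > 0"
  shows "theta1 u \<tau> = 0 \<longleftrightarrow> u \<in> period_lattice \<tau>"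
proof
  obtain K where K0: "K \<noteq> 0" and K: "\<And>u. theta1 u \<tau> = K * sin (of_real pi * u)
           * q_prod (nome \<tau>) (exp (2 * of_real pi * \<i> * u))
           * q_prod (nome \<tau>) (exp (-(2 * of_real pi * \<i> * u)))"
    using theta1_product[OF assms] by metis
  note n1 = norm_nome_less_1[OF assms]
  have pw: "nome \<tau> ^ Suc j * exp (2 * of_real pi * \<i> * z)
      = exp (2 * of_real pi * \<i> * (of_nat (Suc j) * \<tau> + z))" for j z
    unfolding nome_def exp_of_nat_mult[symmetric] exp_add[symmetric]
    by (simp add: algebra_simps)
  have per: "z \<in> \<int>" if "exp (2 * of_real pi * \<i> * z) = 1" for z
    using that by (auto simp: exp_eq_1 complex_is_Int_iff)
  {
    assume "theta1 u \<tau> = 0"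
    then consider "sin (of_real pi * u) = 0"
      | j where "nome \<tau> ^ Suc j * exp (2 * of_real pi * \<i> * u) = 1"
      | j where "nome \<tau> ^ Suc j * exp (2 * of_real pi * \<i> * (-u)) = 1"
      using K0 by (auto simp: K q_prod_eq_0_iff[OF n1])
    then show "u \<in> period_lattice \<tau>"
    proof cases
      case 1
      then obtain n :: int where "of_real pi * u = of_real (of_int n * pi)"
        unfolding Complex_Transcendental.sin_eq_0 by blast
      then have "u = of_int n + of_int 0 * \<tau>" by simp
      then show ?thesis unfolding period_lattice_def by blast
    next
      case (2 j)
      then have "of_nat (Suc j) * \<tau> + u \<in> \<int>" unfolding pw by (rule per)
      then obtain n where "of_nat (Suc j) * \<tau> + u = of_int n" by (auto elim: Ints_cases)
      then have "u = of_int n + of_int (- int (Suc j)) * \<tau>" by (simp add: algebra_simps)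
      then show ?thesis unfolding period_lattice_def by blast
    next
      case (3 j)
      then have "of_nat (Suc j) * \<tau> + -u \<in> \<int>" unfolding pw by (rule per)
      then obtain n where "of_nat (Suc j) * \<tau> + -u = of_int n" by (auto elim: Ints_cases)
      then have "u = of_int (-n) + of_int (int (Suc j)) * \<tau>" by (simp add: algebra_simps)
      then show ?thesis unfolding period_lattice_def by blast
    qed
  }
  assume "u \<in> period_lattice \<tau>"
  then have "theta1 (0 + u) \<tau> = 0 \<longleftrightarrow> theta1 0 \<tau> = 0"
    by (rule period_lattice_invariant[where P = "\<lambda>z. theta1 z \<tau> = 0", rotated 2])
       (simp_all add: theta1_add_1 theta1_add_tau[OF assms])
  then show "theta1 u \<tau> = 0"
    by (simp add: theta1_def)
qed

text \<open>At \<open>u = 0\<close> the sine contributes \<open>\<pi>\<close> and the remaining factors take their nonzero value at \<open>w = 1\<close>.\<close>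

lemma deriv_theta1_0_nonzero:
  assumes "Im \<tau> > 0"
  shows "deriv (\<lambda>u. theta1 u \<tau>) 0 \<noteq> 0"
proof -
  obtain K where K0: "K \<noteq> 0" and K: "\<And>u. theta1 u \<tau> = K * sin (of_real pi * u)
           * q_prod (nome \<tau>) (exp (2 * of_real pi * \<i> * u))
           * q_prod (nome \<tau>) (exp (-(2 * of_real pi * \<i> * u)))"
    using theta1_product[OF assms] by metis
  define G where "G = (\<lambda>u. K * q_prod (nome \<tau>) (exp (2 * of_real pi * \<i> * u))
           * q_prod (nome \<tau>) (exp (-(2 * of_real pi * \<i> * u))))"
  have "G holomorphic_on UNIV"
    unfolding G_def by (intro holomorphic_intros holomorphic_q_prod_compose norm_nome_less_1 assms)
  then have "(G has_field_derivative deriv G 0) (at 0)"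
    by (rule holomorphic_derivI) auto
  then have "((\<lambda>u. sin (of_real pi * u) * G u) has_field_derivative of_real pi * G 0) (at 0)"
    by (auto intro!: derivative_eq_intros)
  also have "(\<lambda>u. sin (of_real pi * u) * G u) = (\<lambda>u. theta1 u \<tau>)"
    by (simp add: K G_def fun_eq_iff mult_ac)
  finally have "deriv (\<lambda>u. theta1 u \<tau>) 0 = of_real pi * G 0"
    by (rule DERIV_imp_deriv)
  then show ?thesis
    using K0 q_prod_1_nonzero[OF norm_nome_less_1[OF assms]] by (simp add: G_def)
qed

section \<open>Quotients of quasi-periodic entire functions\<close>

text \<open>At a zero of \<open>f\<close> the derivative of the multiplier drops out of the product rule.\<close>

lemma deriv_add_quasi_period:
  fixes f E :: "complex \<Rightarrow> complex"
  assumes f: "f holomorphic_on UNIV" and E: "E holomorphic_on UNIV"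
    and shift: "\<And>z. f (z + w) = E z * f z" and z: "f z = 0"
  shows "deriv f (z + w) = E z * deriv f z"
proof -
  have "(f has_field_derivative deriv f (z + w)) (at (z + w))"
    by (rule holomorphic_derivI[OF f]) auto
  then have "((\<lambda>x. f (x + w)) has_field_derivative deriv f (z + w)) (at z)"
    by (simp add: DERIV_shift)
  moreover have "((\<lambda>x. E x * f x) has_field_derivative deriv E z * f z + deriv f z * E z) (at z)"
    by (intro DERIV_mult holomorphic_derivI[OF f] holomorphic_derivI[OF E]) auto
  ultimately show ?thesis
    unfolding shift using DERIV_unique z by (metis add_0 mult.commute mult_zero_right)
qed

text \<open>The value at a zero of the denominator is the limit that l'Hospital's rule gives when that zero is
  simple and the numerator vanishes there as well.\<close>

definition entire_quotient :: "(complex \<Rightarrow> complex) \<Rightarrow> (complex \<Rightarrow> complex) \<Rightarrow> complex \<Rightarrow> complex" where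
  "entire_quotient f h z = (if h z = 0 then deriv f z / deriv h z else f z / h z)"

lemma holomorphic_entire_quotient:
  assumes f: "f holomorphic_on UNIV" and h: "h holomorphic_on UNIV"
    and zeros: "\<And>z. h z = 0 \<Longrightarrow> f z = 0 \<and> deriv h z \<noteq> 0"
  shows "entire_quotient f h holomorphic_on UNIV"
proof -
  have open_nz: "open {x. g x \<noteq> 0}" if "g holomorphic_on UNIV" for g :: "complex \<Rightarrow> complex"
    by (intro open_Collect_neq holomorphic_on_imp_continuous_on[OF that] continuous_on_const)
  have "entire_quotient f h field_differentiable at z" for z
  proof (cases "h z = 0")
    case False
    have "(\<lambda>x. f x / h x) holomorphic_on {x. h x \<noteq> 0}"
      by (intro holomorphic_on_divide holomorphic_on_subset[OF f] holomorphic_on_subset[OF h]) auto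
    then have "entire_quotient f h holomorphic_on {x. h x \<noteq> 0}"
      by (rule holomorphic_transform) (simp add: entire_quotient_def)
    then show ?thesis
      by (rule holomorphic_on_imp_differentiable_at[OF _ open_nz[OF h]]) (use False in simp)
  next
    case True
    \<comment> \<open>Removing the common factor \<open>x - z\<close> leaves a quotient whose denominator is nonzero at \<open>z\<close>.\<close>
    define F where "F = (\<lambda>x. if x = z then deriv f z else (f x - f z) / (x - z))"
    define H where "H = (\<lambda>x. if x = z then deriv h z else (h x - h z) / (x - z))"
    have F: "F holomorphic_on UNIV" and H: "H holomorphic_on UNIV"
      unfolding F_def H_def by (intro pole_lemma_open f h open_UNIV)+
    have "(\<lambda>x. F x / H x) holomorphic_on {x. H x \<noteq> 0}"
      by (intro holomorphic_on_divide holomorphic_on_subset[OF F] holomorphic_on_subset[OF H]) auto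
    then have "entire_quotient f h holomorphic_on {x. H x \<noteq> 0}"
      by (rule holomorphic_transform)
         (use True zeros in \<open>auto simp: F_def H_def entire_quotient_def\<close>)
    then show ?thesis
      by (rule holomorphic_on_imp_differentiable_at[OF _ open_nz[OF H]])
         (use True zeros in \<open>auto simp: H_def\<close>)
  qed
  then show ?thesis
    by (simp add: holomorphic_on_def)
qed

lemma fundamental_parallelogram:
  assumes "Im \<tau> > 0"
  obtains x y l where "0 \<le> x" "x \<le> 1" "0 \<le> y" "y \<le> 1" "l \<in> period_lattice \<tau>"
    and "z = of_real x + of_real y * \<tau> + l"
proof
  define y where "y = Im z / Im \<tau>"
  define x where "x = Re z - y * Re \<tau>"
  show "0 \<le> frac x" "frac x \<le> 1" "0 \<le> frac y" "frac y \<le> 1"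
    using frac_lt_1 by (auto intro: less_imp_le)
  show "of_int \<lfloor>x\<rfloor> + of_int \<lfloor>y\<rfloor> * \<tau> \<in> period_lattice \<tau>"
    unfolding period_lattice_def by blast
  have "z = of_real x + of_real y * \<tau>"
    using assms by (simp add: complex_eq_iff x_def y_def)
  then show "z = of_real (frac x) + of_real (frac y) * \<tau> + (of_int \<lfloor>x\<rfloor> + of_int \<lfloor>y\<rfloor> * \<tau>)"
    by (simp add: frac_def algebra_simps)
qed

text \<open>The multipliers cancel in the quotient, which is therefore an entire function with the two periods
  \<open>1\<close> and \<open>\<tau>\<close>.  It is bounded because a period parallelogram is compact, hence constant.\<close>

lemma quasi_periodic_proportional:
  assumes tau: "Im \<tau> > 0"
    and f: "f holomorphic_on UNIV" and h: "h holomorphic_on UNIV" and E: "E holomorphic_on UNIV"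
    and E0: "\<And>z. E z \<noteq> 0"
    and f1: "\<And>z. f (z + 1) = f z" and h1: "\<And>z. h (z + 1) = h z"
    and ft: "\<And>z. f (z + \<tau>) = E z * f z" and ht: "\<And>z. h (z + \<tau>) = E z * h z"
    and zeros: "\<And>z. h z = 0 \<Longrightarrow> f z = 0 \<and> deriv h z \<noteq> 0"
  obtains K where "\<And>z. f z = K * h z"
proof -
  define q where "q = entire_quotient f h"
  have q: "q holomorphic_on UNIV"
    unfolding q_def by (rule holomorphic_entire_quotient[OF f h zeros])
  have q1: "q (z + 1) = q z" for z
  proof (cases "h z = 0")
    case True
    have "deriv g (z + 1) = 1 * deriv g z"
      if "g holomorphic_on UNIV" "\<And>z. g (z + 1) = g z" "g z = 0" for g
      by (rule deriv_add_quasi_period[where E = "\<lambda>_. 1"]) (use that in auto)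
    from this[OF f f1] this[OF h h1] show ?thesis
      using True zeros by (simp add: q_def entire_quotient_def h1)
  qed (simp add: q_def entire_quotient_def f1 h1)
  have qt: "q (z + \<tau>) = q z" for z
  proof (cases "h z = 0")
    case True
    from deriv_add_quasi_period[OF f E ft] deriv_add_quasi_period[OF h E ht] show ?thesis
      using True zeros E0 by (simp add: q_def entire_quotient_def ht)
  qed (use E0 in \<open>simp add: q_def entire_quotient_def ft ht\<close>)
  define P where "P = (\<lambda>(x,y). of_real x + of_real y * \<tau>) ` ({0..1::real} \<times> {0..1::real})"
  have "compact P"
    unfolding P_def case_prod_beta
    by (intro compact_continuous_image compact_Times compact_Icc continuous_intros)
  then have "bounded (q ` P)"
    by (intro compact_imp_bounded compact_continuous_image
          holomorphic_on_imp_continuous_on holomorphic_on_subset[OF q]) auto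
  then obtain B where B: "\<And>z. z \<in> P \<Longrightarrow> norm (q z) \<le> B"
    by (auto simp: bounded_iff)
  have "norm (q z) \<le> B" for z
  proof -
    obtain x y l where xy: "0 \<le> x" "x \<le> 1" "0 \<le> y" "y \<le> 1" and l: "l \<in> period_lattice \<tau>"
      and z: "z = of_real x + of_real y * \<tau> + l"
      using fundamental_parallelogram[OF tau] by metis
    have "of_real x + of_real y * \<tau> \<in> P"
      using xy by (force simp: P_def)
    then show ?thesis
      unfolding z using period_lattice_invariant[where P = "\<lambda>z. norm (q z) \<le> B", OF _ _ l]
      by (simp add: q1 qt B)
  qed
  then have "q constant_on UNIV"
    by (intro Liouville_theorem[OF q]) (auto simp: bounded_iff)
  then obtain K where "\<And>z. q z = K"
    by (auto simp: constant_on_def)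
  then have "f z = K * h z" for z
    using zeros[of z] by (cases "h z = 0") (auto simp: q_def entire_quotient_def divide_simps dest: meta_spec[of _ z])
  then show thesis
    by (rule that)
qed

section \<open>The three-term relation\<close>

text \<open>The properties of \<open>u \<mapsto> \<theta>\<^sub>1(u|\<tau>)\<close> on which the three-term relation depends.\<close>

locale odd_theta =
  fixes T :: "complex \<Rightarrow> complex" and \<tau> :: complex
  assumes Im_tau: "Im \<tau> > 0"
    and holo: "T holomorphic_on UNIV"
    and minus: "T (-z) = - T z"
    and add_1: "T (z + 1) = - T z"
    and add_tau: "T (z + \<tau>) = - exp (-(of_real pi * \<i> * (2 * z + \<tau>))) * T z"
    and eq_0_iff: "T z = 0 \<longleftrightarrow> z \<in> period_lattice \<tau>"
    and deriv_0: "deriv T 0 \<noteq> 0"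
begin

text \<open>The name alludes to the two-dimensional cross product: by \<open>three_term\<close> below, the function is
  a two-by-two determinant in its two arguments.\<close>

definition cross :: "complex \<Rightarrow> complex \<Rightarrow> complex" where
  "cross c z = T (c + z) * T (c - z)"

lemma T_0: "T 0 = 0"
  using minus[of 0] by simp

text \<open>Every zero is a translate of \<open>0\<close> by a period, and translation preserves simple zeros.\<close>

lemma deriv_at_zero:
  assumes "T z = 0"
  shows "deriv T z \<noteq> 0"
proof -
  let ?P = "\<lambda>z. T z = 0 \<and> deriv T z \<noteq> 0"
  let ?E = "\<lambda>z. - exp (-(of_real pi * \<i> * (2 * z + \<tau>)))"
  have "?P (0 + z) \<longleftrightarrow> ?P 0"
  proof (rule period_lattice_invariant)
    show "z \<in> period_lattice \<tau>"
      using assms by (simp add: eq_0_iff)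
    show "?P (w + 1) \<longleftrightarrow> ?P w" for w
      using deriv_add_quasi_period[OF holo, of "\<lambda>_. -1" 1 w] by (auto simp: add_1)
    have "?E holomorphic_on UNIV"
      by (intro holomorphic_intros)
    then show "?P (w + \<tau>) \<longleftrightarrow> ?P w" for w
      using deriv_add_quasi_period[OF holo, of ?E \<tau> w] by (auto simp: add_tau)
  qed
  then show ?thesis
    by (simp add: T_0 deriv_0)
qed

lemma holomorphic_cross: "cross c holomorphic_on UNIV"
proof -
  have *: "(\<lambda>z. T (f z)) holomorphic_on UNIV" if "f holomorphic_on UNIV" for f
    using holomorphic_on_compose_gen[OF that holo] by (simp add: o_def)
  then show ?thesis
    unfolding cross_def by (intro holomorphic_on_mult *) (intro holomorphic_intros)+
qed

lemma deriv_cross: "deriv (cross c) z = deriv T (c + z) * T (c - z) - T (c + z) * deriv T (c - z)"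
proof -
  have T: "(T has_field_derivative deriv T x) (at x)" for x
    by (rule holomorphic_derivI[OF holo]) auto
  show ?thesis
    unfolding cross_def
    by (rule DERIV_imp_deriv) (auto intro!: derivative_eq_intros DERIV_chain2[OF T] simp: algebra_simps)
qed

lemma cross_swap: "cross z c = - cross c z"
  using minus[of "c - z"] by (simp add: cross_def add.commute)

lemma cross_self: "cross c c = 0"
  by (simp add: cross_def T_0)

lemma cross_minus: "cross c (-z) = cross c z"
  by (simp add: cross_def mult.commute)

lemma cross_add_1: "cross c (z + 1) = cross c z"
  using add_1[of "c + z"] add_1[of "c - z - 1"] by (simp add: cross_def algebra_simps)

lemma cross_add_tau: "cross c (z + \<tau>) = exp (-(2 * of_real pi * \<i> * (2 * z + \<tau>))) * cross c z"
proof -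
  let ?e = "\<lambda>z. exp (-(of_real pi * \<i> * (2 * z + \<tau>)))"
  have "?e (c + z) = exp (-(2 * of_real pi * \<i> * (2 * z + \<tau>))) * ?e (c - z - \<tau>)"
    unfolding exp_add[symmetric] by (simp add: algebra_simps)
  moreover have "T (c + (z + \<tau>)) = - ?e (c + z) * T (c + z)"
    using add_tau[of "c + z"] by (simp add: add.assoc)
  moreover have "T (c - z) = - ?e (c - z - \<tau>) * T (c - (z + \<tau>))"
    using add_tau[of "c - z - \<tau>"] by (simp add: diff_diff_eq)
  ultimately show ?thesis
    by (simp add: cross_def)
qed

text \<open>The two factors vanish at \<open>-a\<close> and at \<open>a\<close> modulo periods, and these classes differ
  exactly when \<open>2 a\<close> is not a period.\<close>

lemma simple_zero_cross:
  assumes "T (2 * a) \<noteq> 0" and "cross a z = 0"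
  shows "deriv (cross a) z \<noteq> 0"
proof -
  have "T (a + z) \<noteq> 0 \<or> T (a - z) \<noteq> 0"
  proof (rule ccontr)
    assume "\<not> ?thesis"
    then have "T (a + z) = 0" "T (a - z) = 0" by auto
    then have "T ((a + z) + (a - z)) = 0"
      using period_lattice_invariant[where P = "\<lambda>z. T z = 0" and \<tau> = \<tau>, of "a - z" "a + z"]
      by (simp add: add_1 add_tau eq_0_iff[of "a - z"])
    then show False
      using assms(1) by simp
  qed
  then show ?thesis
    using assms(2) deriv_at_zero by (auto simp: deriv_cross cross_def)
qed

text \<open>As functions of \<open>z\<close>, the difference \<open>f\<close> of the two sides and \<open>cross a\<close> have the same
  quasi-periods, and \<open>f\<close> vanishes at the zeros of \<open>cross a\<close>, hence is a constant multiple of it.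
  Since \<open>f\<close> vanishes at \<open>b\<close> as well, where \<open>cross a\<close> does not, the multiple is zero.\<close>

lemma three_term_special:
  assumes a: "T (2 * a) \<noteq> 0" and ab: "cross a b \<noteq> 0"
  shows "cross c z * cross a b = cross c b * cross a z - cross c a * cross b z"
proof -
  define f where "f = (\<lambda>z. cross c b * cross a z - cross c a * cross b z - cross c z * cross a b)"
  have f_a: "f a = 0"
    using cross_swap[of a b] by (simp add: f_def cross_self)
  have f_b: "f b = 0"
    by (simp add: f_def cross_self)
  have f_minus: "f (-z) = f z" for z
    by (simp add: f_def cross_minus)
  have f1: "f (z + 1) = f z" for z
    by (simp add: f_def cross_add_1)
  have ft: "f (z + \<tau>) = exp (-(2 * of_real pi * \<i> * (2 * z + \<tau>))) * f z" for z
    unfolding f_def cross_add_tau by (simp only: right_diff_distrib mult_ac)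
  have zeros: "f z = 0 \<and> deriv (cross a) z \<noteq> 0" if z: "cross a z = 0" for z
  proof
    show "deriv (cross a) z \<noteq> 0"
      by (rule simple_zero_cross[OF a z])
    have inv: "f (w + l) = 0 \<longleftrightarrow> f w = 0" if "T l = 0" for w l
      by (rule period_lattice_invariant[where \<tau> = \<tau>]) (use that in \<open>auto simp: f1 ft eq_0_iff\<close>)
    from z consider "T (a + z) = 0" | "T (z - a) = 0"
      using minus[of "a - z"] by (auto simp: cross_def)
    then show "f z = 0"
    proof cases
      case 1
      then show ?thesis using inv[of "a + z" "-a"] by (simp add: f_a f_minus)
    next
      case 2
      then show ?thesis using inv[of "z - a" a] by (simp add: f_a)
    qed
  qed
  obtain K where K: "\<And>z. f z = K * cross a z"
  proof (rule quasi_periodic_proportional[OF Im_tau _ holomorphic_cross[of a] _ _ f1 cross_add_1 ft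
        cross_add_tau zeros])
    show "f holomorphic_on UNIV"
      unfolding f_def by (intro holomorphic_intros holomorphic_cross)
    show "(\<lambda>z. exp (-(2 * of_real pi * \<i> * (2 * z + \<tau>)))) holomorphic_on UNIV"
      by (intro holomorphic_intros)
  qed auto
  have "K = 0"
    using K[of b] f_b ab by simp
  then have "f z = 0"
    by (simp add: K)
  then show ?thesis
    by (simp add: f_def)
qed

lemma T_real_nonzero:
  assumes "0 < t" "t < 1"
  shows "T (of_real t) \<noteq> 0"
proof
  assume "T (of_real t) = 0"
  then obtain m n :: int where mn: "of_real t = of_int m + of_int n * \<tau>"
    by (auto simp: eq_0_iff period_lattice_def)
  have "of_int n * Im \<tau> = 0"
    using arg_cong[OF mn, of Im] by simp
  then have "n = 0"
    using Im_tau by simp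
  then have "t = of_int m"
    using mn by (metis add.right_neutral mult_zero_left of_int_0 of_real_eq_iff of_real_of_int_eq)
  then show False
    using assms by simp
qed

lemma cross_real_nonzero:
  assumes "0 < s" "s < 1/2" "0 < t" "t < 1/2" "s \<noteq> t"
  shows "cross (of_real s) (of_real t) \<noteq> 0"
proof -
  have "T (of_real s + of_real t) \<noteq> 0"
    using T_real_nonzero[of "s + t"] assms by simp
  moreover have "T (of_real s - of_real t) \<noteq> 0"
  proof (cases "s > t")
    case True
    then show ?thesis using T_real_nonzero[of "s - t"] assms by simp
  next
    case False
    then show ?thesis using T_real_nonzero[of "t - s"] minus[of "of_real (t - s)"] assms by simp
  qed
  ultimately show ?thesis
    by (simp add: cross_def)
qed

text \<open>Two reference points at which \<open>three_term_special\<close> applies suffice: it exhibits \<open>cross c w\<close> as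
  a determinant \<open>u(c) v(w) - v(c) u(w)\<close> for all \<open>c\<close> and \<open>w\<close>, up to a nonzero constant, and
  determinants satisfy the Pluecker relation identically.  This frees \<open>a\<close> and \<open>b\<close> from all
  conditions, half-periods included.\<close>

theorem three_term:
  "cross m z * cross a b = cross m b * cross a z - cross m a * cross b z"
proof -
  \<comment> \<open>Any two distinct real numbers strictly between \<open>0\<close> and \<open>1/2\<close> serve as reference points.\<close>
  define u where "u = cross (of_real (1/4))"
  define v where "v = cross (of_real (1/3))"
  define D where "D = cross (of_real (1/4)) (of_real (1/3))"
  have D: "D \<noteq> 0"
    unfolding D_def by (rule cross_real_nonzero) auto
  have "T (2 * of_real (1/4)) \<noteq> 0"
    using T_real_nonzero[of "1/2"] by simp
  from three_term_special[OF this D[unfolded D_def]]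
  have det: "cross c w * D = u c * v w - v c * u w" for c w
    unfolding D_def u_def v_def
    by (simp only: cross_swap[of c "of_real (1/4)"] cross_swap[of c "of_real (1/3)"]) simp
  have "(cross m z * D) * (cross a b * D) - (cross m b * D) * (cross a z * D)
      + (cross m a * D) * (cross b z * D) = 0"
    unfolding det by (simp add: algebra_simps)
  then have "(cross m z * cross a b - cross m b * cross a z + cross m a * cross b z) * (D * D) = 0"
    by (simp add: algebra_simps)
  then have "cross m z * cross a b - cross m b * cross a z + cross m a * cross b z = 0"
    using D by simp
  then show ?thesis
    by (simp add: diff_add_eq eq_diff_eq)
qed

end

lemma odd_theta_theta1:
  assumes "Im \<tau> > 0"
  shows "odd_theta (\<lambda>u. theta1 u \<tau>) \<tau>"
  by unfold_locales (intro assms holomorphic_theta1 theta1_minus theta1_add_1 theta1_add_tau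
      theta1_eq_0_iff deriv_theta1_0_nonzero)+

section \<open>Products of linear forms in two variables\<close>

text \<open>
  Here \<open>H\<close> is any function of two arguments subject to the Pluecker relation.  One reads
  \<open>H a\<close> as the linear form with root \<open>a\<close>, and \<open>H a b \<noteq> 0\<close> as the independence of the
  forms \<open>H a\<close> and \<open>H b\<close>.
\<close>

definition form_prod :: "('a \<Rightarrow> 'b \<Rightarrow> 'c::comm_ring_1) \<Rightarrow> (nat \<Rightarrow> 'a) \<Rightarrow> nat \<Rightarrow> 'b \<Rightarrow> 'c" where
  "form_prod H A n z = (\<Prod>i<n. H (A i) z)"

lemma form_prod_Suc: "form_prod H A (Suc n) z = form_prod H A n z * H (A n) z"
  by (simp add: form_prod_def)

text \<open>The independence hypothesis enters only at the pairs \<open>A j\<close>, \<open>B (k - j)\<close> in the step from \<open>k\<close> to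
  \<open>k + 1\<close>; together these steps use all index pairs with \<open>i + j < k\<close>.\<close>

lemma form_prod_in_span:
  fixes H :: "'a \<Rightarrow> 'a \<Rightarrow> 'c::field"
  assumes pl: "\<And>m z a b. H m z * H a b = H m b * H a z - H m a * H b z"
    and indep: "\<And>i j. i + j < k \<Longrightarrow> H (A i) (B j) \<noteq> 0"
  shows "\<exists>c. \<forall>z. form_prod H C k z = (\<Sum>j\<le>k. c j * (form_prod H A j z * form_prod H B (k - j) z))"
  using indep
proof (induction k)
  case 0
  show ?case by (rule exI[of _ "\<lambda>_. 1"]) (simp add: form_prod_def)
next
  case (Suc k)
  then obtain c where
    c: "\<And>z. form_prod H C k z = (\<Sum>j\<le>k. c j * (form_prod H A j z * form_prod H B (k - j) z))"
    by (metis less_SucI)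
  \<comment> \<open>Coordinates of the new factor \<open>H (C k)\<close> with respect to \<open>H (A j)\<close> and \<open>H (B (k - j))\<close>, by
    Cramer's rule.\<close>
  define d where "d j = H (A j) (B (k - j))" for j
  define x where "x j = H (C k) (B (k - j)) / d j" for j
  define y where "y j = - H (C k) (A j) / d j" for j
  have lin: "H (C k) z = x j * H (A j) z + y j * H (B (k - j)) z" if "j \<le> k" for j z
  proof -
    have "d j \<noteq> 0" using Suc.prems[of j "k - j"] that by (simp add: d_def)
    moreover have "H (C k) z * d j = H (C k) (B (k - j)) * H (A j) z - H (C k) (A j) * H (B (k - j)) z"
      unfolding d_def by (rule pl)
    ultimately show ?thesis by (simp add: x_def y_def field_simps)
  qed
  define c' where "c' j = (case j of 0 \<Rightarrow> 0 | Suc i \<Rightarrow> c i * x i) + (if j \<le> k then c j * y j else 0)" for j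
  show ?case
  proof (rule exI[of _ c'], rule allI)
    fix z
    let ?E = "\<lambda>j. form_prod H A j z * form_prod H B (Suc k - j) z"
    have "form_prod H C (Suc k) z = (\<Sum>j\<le>k. c j * (form_prod H A j z * form_prod H B (k - j) z) * H (C k) z)"
      by (simp add: form_prod_Suc c sum_distrib_right)
    also have "\<dots> = (\<Sum>j\<le>k. c j * x j * ?E (Suc j) + c j * y j * ?E j)"
    proof (rule sum.cong[OF refl])
      fix j assume "j \<in> {..k}"
      then have "j \<le> k" by simp
      then show "c j * (form_prod H A j z * form_prod H B (k - j) z) * H (C k) z
          = c j * x j * ?E (Suc j) + c j * y j * ?E j"
        by (simp add: lin Suc_diff_le form_prod_Suc algebra_simps)
    qed
    also have "\<dots> = (\<Sum>j\<le>k. c j * x j * ?E (Suc j)) + (\<Sum>j\<le>k. c j * y j * ?E j)"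
      by (rule sum.distrib)
    also have "(\<Sum>j\<le>k. c j * x j * ?E (Suc j)) = (\<Sum>j\<le>Suc k. (case j of 0 \<Rightarrow> 0 | Suc i \<Rightarrow> c i * x i) * ?E j)"
      by (subst sum.atMost_Suc_shift) simp
    also have "(\<Sum>j\<le>k. c j * y j * ?E j) = (\<Sum>j\<le>Suc k. (if j \<le> k then c j * y j else 0) * ?E j)"
      by simp
    finally show "form_prod H C (Suc k) z = (\<Sum>j\<le>Suc k. c' j * ?E j)"
      by (simp only: c'_def distrib_right sum.distrib)
  qed
qed

lemma left_inverse_imp_right_inverse:
  fixes M N :: "nat \<Rightarrow> nat \<Rightarrow> 'a::field"
  assumes "\<And>i s. i < n \<Longrightarrow> s < n \<Longrightarrow> (\<Sum>j<n. M i j * N j s) = (if i = s then 1 else 0)"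
    and "i < n" "s < n"
  shows "(\<Sum>j<n. N i j * M j s) = (if i = s then 1 else 0)"
proof -
  let ?M = "mat n n (\<lambda>(i,j). M i j)" and ?N = "mat n n (\<lambda>(i,j). N i j)"
  have prod_entry: "(mat n n (\<lambda>(i,j). P i j) * mat n n (\<lambda>(i,j). Q i j)) $$ (i,s) = (\<Sum>j<n. P i j * Q j s)"
    if "i < n" "s < n" for P Q :: "nat \<Rightarrow> nat \<Rightarrow> 'a" and i s
    using that by (simp add: scalar_prod_def atLeast0LessThan)
  have "?M * ?N = 1\<^sub>m n"
    by (rule eq_matI) (use prod_entry[of _ _ M N] assms(1) in \<open>auto simp del: index_mult_mat(1)\<close>)
  then have "?N * ?M = 1\<^sub>m n"
    by (rule mat_mult_left_right_inverse[rotated 2]) auto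
  then show ?thesis
    using prod_entry[OF assms(2,3), of N M] assms(2,3) by simp
qed

text \<open>The product over all points but \<open>Z s\<close> vanishes at these points and not at \<open>Z s\<close>.  Expanding it
  in the basis products \<open>E j\<close> shows that the square matrix of the values \<open>E j (Z s)\<close> has a left inverse.
  Being square, it then has a right inverse too, and a vanishing combination of the
  \<open>E j\<close> is trivial.  Evaluating only at these points avoids a separate treatment of repeated factors among the
  \<open>A i\<close> or the \<open>B i\<close>, which genericity permits.\<close>

lemma form_prods_independent:
  fixes H :: "'a \<Rightarrow> 'a \<Rightarrow> 'c::field"
  assumes pl: "\<And>m z a b. H m z * H a b = H m b * H a z - H m a * H b z"
    and self: "\<And>a. H a a = 0"
    and indep: "\<And>i j. i + j < k \<Longrightarrow> H (A i) (B j) \<noteq> 0"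
    and points: "\<And>s t::nat. s \<noteq> t \<Longrightarrow> H (Z s) (Z t) \<noteq> 0"
    and zero: "\<And>z. (\<Sum>j\<le>k. d j * (form_prod H A j z * form_prod H B (k - j) z)) = 0"
    and i: "i \<le> k"
  shows "d i = 0"
proof -
  define E where "E j z = form_prod H A j z * form_prod H B (k - j) z" for j z
  \<comment> \<open>The sequence \<open>Z\<close> with its entry at position \<open>s\<close> omitted.\<close>
  define Y where "Y s l = (if l < s then Z l else Z (Suc l))" for s l
  have "\<forall>s. \<exists>c. \<forall>z. form_prod H (Y s) k z = (\<Sum>j\<le>k. c j * E j z)"
    unfolding E_def by (intro allI form_prod_in_span pl indep)
  then obtain c where c: "\<And>s z. form_prod H (Y s) k z = (\<Sum>j\<le>k. c s j * E j z)"
    by metis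
  have diag: "form_prod H (Y s) k (Z s) \<noteq> 0" for s
    using points by (auto simp: form_prod_def Y_def)
  have offdiag: "form_prod H (Y s) k (Z t) = 0" if "s \<le> k" "t \<le> k" "s \<noteq> t" for s t
  proof -
    have "\<exists>l<k. Y s l = Z t"
    proof (cases "t < s")
      case True
      then show ?thesis using that by (intro exI[of _ t]) (auto simp: Y_def)
    next
      case False
      then show ?thesis using that by (intro exI[of _ "t - 1"]) (auto simp: Y_def)
    qed
    then show ?thesis
      using self by (force simp: form_prod_def)
  qed
  define M where "M s j = c s j / form_prod H (Y s) k (Z s)" for s j
  have MN: "(\<Sum>j<Suc k. M s j * E j (Z t)) = (if s = t then 1 else 0)" if "s < Suc k" "t < Suc k" for s t
  proof -
    have "(\<Sum>j<Suc k. M s j * E j (Z t)) = form_prod H (Y s) k (Z t) / form_prod H (Y s) k (Z s)"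
      by (simp add: M_def c lessThan_Suc_atMost sum_divide_distrib)
    then show ?thesis
      using diag offdiag that by auto
  qed
  have "0 = (\<Sum>s<Suc k. (\<Sum>j<Suc k. d j * E j (Z s)) * M s i)"
    using zero by (simp only: E_def lessThan_Suc_atMost) simp
  also have "\<dots> = (\<Sum>s<Suc k. \<Sum>j<Suc k. d j * (E j (Z s) * M s i))"
    by (simp only: sum_distrib_right mult.assoc)
  also have "\<dots> = (\<Sum>j<Suc k. d j * (\<Sum>s<Suc k. E j (Z s) * M s i))"
    by (subst sum.swap) (simp only: sum_distrib_left)
  also have "\<dots> = (\<Sum>j<Suc k. d j * (if j = i then 1 else 0))"
    using left_inverse_imp_right_inverse[where M = M and N = "\<lambda>j s. E j (Z s)", OF MN] i
    by (intro sum.cong) auto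
  also have "\<dots> = d i"
    using i by (subst sum.cong[OF refl, of _ _ "\<lambda>j. if j = i then d j else 0"]) auto
  finally show ?thesis by simp
qed

section \<open>Expansions in the natural basis\<close>

definition bracket_form :: "complex \<Rightarrow> complex \<Rightarrow> complex \<Rightarrow> complex \<Rightarrow> complex" where
  "bracket_form \<tau> r c w = bracket \<tau> r (c + w) * bracket \<tau> r (c - w)"

lemma bracket_form_cross:
  assumes "Im \<tau> > 0"
  shows "bracket_form \<tau> r c w = bracket_const \<tau> r ^ 2 * odd_theta.cross (\<lambda>u. theta1 u \<tau>) (c / r) (w / r)"
  by (simp add: bracket_form_def bracket_def odd_theta.cross_def[OF odd_theta_theta1[OF assms]]
      add_divide_distrib diff_divide_distrib power2_eq_square)

lemma bracket_form_three_term: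
  assumes "Im \<tau> > 0"
  shows "bracket_form \<tau> r m z * bracket_form \<tau> r a b
    = bracket_form \<tau> r m b * bracket_form \<tau> r a z - bracket_form \<tau> r m a * bracket_form \<tau> r b z"
proof -
  have *: "(C * x) * (C * y) = (C * x') * (C * y') - (C * x'') * (C * y'')"
    if "x * y = x' * y' - x'' * y''" for C x y x' y' x'' y'' :: complex
    using arg_cong[OF that, of "\<lambda>t. C * C * t"] by (simp add: algebra_simps)
  show ?thesis
    unfolding bracket_form_cross[OF assms]
    by (rule *) (rule odd_theta.three_term[OF odd_theta_theta1[OF assms]])
qed

lemma bracket_const_nonzero:
  assumes "Im \<tau> > 0"
  shows "bracket_const \<tau> r \<noteq> 0"
  using assms by (auto simp: bracket_const_def x_pow_def)

lemma bracket_form_eq_0_iff: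
  assumes "Im \<tau> > 0"
  shows "bracket_form \<tau> r c w = 0
    \<longleftrightarrow> (c + w) / r \<in> period_lattice \<tau> \<or> (c - w) / r \<in> period_lattice \<tau>"
  using assms by (simp add: bracket_form_def bracket_def bracket_const_nonzero theta1_eq_0_iff)

lemma nat_basis_eq_form_prod:
  "nat_basis \<tau> r k n \<alpha> \<beta> z =
     form_prod (bracket_form \<tau> r) (\<lambda>i. \<alpha> + of_nat i) n (r * z)
       * form_prod (bracket_form \<tau> r) (\<lambda>i. \<beta> + of_nat i) (k - n) (r * z)"
  by (simp add: nat_basis_def bracket_poch_def form_prod_def bracket_form_def prod.distrib algebra_simps)

lemma generic_pair_nonzero:
  assumes "Im \<tau> > 0" "generic_pair \<tau> r k \<gamma> \<delta>" "i + j < k"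
  shows "bracket_form \<tau> r (\<gamma> + of_nat i) (\<delta> + of_nat j) \<noteq> 0"
proof -
  have "int i - int j \<in> {1 - int k..int k - 1}" "int (i + j) \<in> {0..int k - 1}"
    using assms(3) by auto
  then have "(\<gamma> - \<delta> + of_int (int i - int j)) / r \<notin> period_lattice \<tau>"
    "(\<gamma> + \<delta> + of_int (int (i + j))) / r \<notin> period_lattice \<tau>"
    using assms(2) unfolding generic_pair_def by (blast dest: bspec)+
  then show ?thesis
    using assms(1) by (simp add: bracket_form_eq_0_iff algebra_simps)
qed

text \<open>The points required by \<open>form_prods_independent\<close>: scaled by \<open>1 / r\<close> they are distinct real numbers strictly between
  \<open>0\<close> and \<open>1/2\<close>, so that neither their sums nor their differences are periods.\<close>

lemma bracket_form_points:
  assumes "Im \<tau> > 0" and "r \<noteq> 0" and "s \<noteq> t"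
  shows "bracket_form \<tau> r (r * of_real (1 / (real s + 3))) (r * of_real (1 / (real t + 3))) \<noteq> 0"
proof -
  have "odd_theta.cross (\<lambda>u. theta1 u \<tau>) (of_real (1 / (real s + 3))) (of_real (1 / (real t + 3))) \<noteq> 0"
    by (rule odd_theta.cross_real_nonzero[OF odd_theta_theta1[OF assms(1)]])
       (use assms(3) in \<open>auto simp: field_simps\<close>)
  then show ?thesis
    using assms by (simp add: bracket_form_cross bracket_const_nonzero)
qed

lemma nat_basis_expansion_exists:
  assumes "Im \<tau> > 0" "generic_pair \<tau> r k \<gamma> \<delta>" "n \<le> k"
  shows "\<exists>c. \<forall>z. nat_basis \<tau> r k n \<alpha> \<beta> z = (\<Sum>j\<le>k. c j * nat_basis \<tau> r k j \<gamma> \<delta> z)"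
proof -
  let ?H = "bracket_form \<tau> r"
  let ?C = "\<lambda>i. if i < n then \<alpha> + of_nat i else \<beta> + of_nat (i - n)"
  have "form_prod ?H ?C k w
      = form_prod ?H (\<lambda>i. \<alpha> + of_nat i) n w * form_prod ?H (\<lambda>i. \<beta> + of_nat i) (k - n) w" for w
  proof -
    have "form_prod ?H ?C (n + m) w
        = form_prod ?H (\<lambda>i. \<alpha> + of_nat i) n w * form_prod ?H (\<lambda>i. \<beta> + of_nat i) m w" for m
      by (induction m) (simp_all add: form_prod_Suc mult.assoc, simp_all add: form_prod_def)
    from this[of "k - n"] show ?thesis using assms(3) by simp
  qed
  moreover have "\<exists>c. \<forall>w. form_prod ?H ?C k w
      = (\<Sum>j\<le>k. c j * (form_prod ?H (\<lambda>i. \<gamma> + of_nat i) j w * form_prod ?H (\<lambda>i. \<delta> + of_nat i) (k - j) w))"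
    by (rule form_prod_in_span) (rule bracket_form_three_term[OF assms(1)], rule generic_pair_nonzero[OF assms(1,2)])
  then obtain c where "\<And>w. form_prod ?H ?C k w
      = (\<Sum>j\<le>k. c j * (form_prod ?H (\<lambda>i. \<gamma> + of_nat i) j w * form_prod ?H (\<lambda>i. \<delta> + of_nat i) (k - j) w))"
    by blast
  ultimately have "nat_basis \<tau> r k n \<alpha> \<beta> z = (\<Sum>j\<le>k. c j * nat_basis \<tau> r k j \<gamma> \<delta> z)" for z
    by (simp only: nat_basis_eq_form_prod)
  then show ?thesis
    by blast
qed

lemma nat_basis_independent:
  assumes "Im \<tau> > 0" "r \<noteq> 0" "generic_pair \<tau> r k \<gamma> \<delta>"
    and zero: "\<And>z. (\<Sum>j\<le>k. d j * nat_basis \<tau> r k j \<gamma> \<delta> z) = 0" and "i \<le> k"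
  shows "d i = 0"
proof (rule form_prods_independent[OF bracket_form_three_term[OF assms(1)] _
        generic_pair_nonzero[OF assms(1,3)] bracket_form_points[OF assms(1,2)] _ \<open>i \<le> k\<close>])
  show "bracket_form \<tau> r a a = 0" for a
    by (simp add: bracket_form_def bracket_def theta1_def)
  show "(\<Sum>j\<le>k. d j * (form_prod (bracket_form \<tau> r) (\<lambda>i. \<gamma> + of_nat i) j w
      * form_prod (bracket_form \<tau> r) (\<lambda>i. \<delta> + of_nat i) (k - j) w)) = 0" for w
    using zero[of "w / r"] assms(2) by (simp add: nat_basis_eq_form_prod)
qed

lemma elliptic_6j_eqI:
  assumes "Im \<tau> > 0" "r \<noteq> 0" "generic_pair \<tau> r k \<gamma> \<delta>"
    and c: "\<And>z. nat_basis \<tau> r k n \<alpha> \<beta> z = (\<Sum>j\<le>k. c j * nat_basis \<tau> r k j \<gamma> \<delta> z)"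
    and "m \<le> k"
  shows "elliptic_6j \<tau> r k n m \<alpha> \<beta> \<gamma> \<delta> = c m"
proof -
  \<comment> \<open>The definition of the symbols normalizes the coefficients beyond \<open>k\<close> to \<open>0\<close>.\<close>
  define c' where "c' j = (if j \<le> k then c j else 0)" for j
  have c': "nat_basis \<tau> r k n \<alpha> \<beta> z = (\<Sum>j\<le>k. c' j * nat_basis \<tau> r k j \<gamma> \<delta> z)" for z
    by (simp add: c c'_def)
  have "(THE c. (\<forall>j>k. c j = 0) \<and>
      (\<forall>z. nat_basis \<tau> r k n \<alpha> \<beta> z = (\<Sum>j\<le>k. c j * nat_basis \<tau> r k j \<gamma> \<delta> z))) = c'"
  proof (rule the_equality)
    show "(\<forall>j>k. c' j = 0) \<and>
        (\<forall>z. nat_basis \<tau> r k n \<alpha> \<beta> z = (\<Sum>j\<le>k. c' j * nat_basis \<tau> r k j \<gamma> \<delta> z))"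
      using c' by (simp add: c'_def)
    fix b assume b: "(\<forall>j>k. b j = 0) \<and>
        (\<forall>z. nat_basis \<tau> r k n \<alpha> \<beta> z = (\<Sum>j\<le>k. b j * nat_basis \<tau> r k j \<gamma> \<delta> z))"
    have "(\<Sum>j\<le>k. (b j - c' j) * nat_basis \<tau> r k j \<gamma> \<delta> z) = 0" for z
    proof -
      have "(\<Sum>j\<le>k. b j * nat_basis \<tau> r k j \<gamma> \<delta> z) = (\<Sum>j\<le>k. c' j * nat_basis \<tau> r k j \<gamma> \<delta> z)"
        using b c'[of z] by simp
      then show ?thesis
        by (simp add: left_diff_distrib sum_subtractf)
    qed
    then have "b j - c' j = 0" if "j \<le> k" for j
      using nat_basis_independent[OF assms(1-3), of "\<lambda>j. b j - c' j"] that by blast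
    then show "b = c'"
      using b by (auto simp: fun_eq_iff c'_def)
  qed
  then show ?thesis
    using \<open>m \<le> k\<close> by (simp add: elliptic_6j_def c'_def)
qed

lemma elliptic_6j_expansion:
  assumes "Im \<tau> > 0" "r \<noteq> 0" "generic_pair \<tau> r k \<gamma> \<delta>" "n \<le> k"
  shows "nat_basis \<tau> r k n \<alpha> \<beta> z
    = (\<Sum>j\<le>k. elliptic_6j \<tau> r k n j \<alpha> \<beta> \<gamma> \<delta> * nat_basis \<tau> r k j \<gamma> \<delta> z)"
proof -
  obtain c where c: "\<And>z. nat_basis \<tau> r k n \<alpha> \<beta> z = (\<Sum>j\<le>k. c j * nat_basis \<tau> r k j \<gamma> \<delta> z)"
    using nat_basis_expansion_exists[OF assms(1,3,4)] by metis
  show ?thesis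
    unfolding c by (intro sum.cong refl) (simp add: elliptic_6j_eqI[OF assms(1-3) c])
qed

theorem proposition3p6:
  fixes \<tau> r \<alpha> \<beta> \<gamma> \<delta> \<rho> \<sigma> :: complex and k n m :: nat
  assumes "Im \<tau> > 0" and "r \<noteq> 0"
    and "k \<ge> 1" and "n \<le> k" and "m \<le> k"
    and "generic_pair \<tau> r k \<alpha> \<beta>"
    and "generic_pair \<tau> r k \<rho> \<sigma>"
    and "generic_pair \<tau> r k \<gamma> \<delta>"
  shows "elliptic_6j \<tau> r k n m \<alpha> \<beta> \<gamma> \<delta> =
    (\<Sum>l = 0..k. elliptic_6j \<tau> r k n l \<alpha> \<beta> \<rho> \<sigma> * elliptic_6j \<tau> r k l m \<rho> \<sigma> \<gamma> \<delta>)"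
proof (rule elliptic_6j_eqI[OF assms(1,2,8) _ assms(5)])
  fix z
  let ?R = "\<lambda>l. elliptic_6j \<tau> r k n l \<alpha> \<beta> \<rho> \<sigma>"
  let ?S = "\<lambda>l j. elliptic_6j \<tau> r k l j \<rho> \<sigma> \<gamma> \<delta>"
  have "nat_basis \<tau> r k n \<alpha> \<beta> z = (\<Sum>l\<le>k. ?R l * nat_basis \<tau> r k l \<rho> \<sigma> z)"
    by (rule elliptic_6j_expansion[OF assms(1,2,7,4)])
  also have "\<dots> = (\<Sum>l\<le>k. \<Sum>j\<le>k. ?R l * ?S l j * nat_basis \<tau> r k j \<gamma> \<delta> z)"
  proof (intro sum.cong refl)
    fix l assume "l \<in> {..k}"
    then have "nat_basis \<tau> r k l \<rho> \<sigma> z = (\<Sum>j\<le>k. ?S l j * nat_basis \<tau> r k j \<gamma> \<delta> z)"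
      by (intro elliptic_6j_expansion[OF assms(1,2,8)]) simp
    then show "?R l * nat_basis \<tau> r k l \<rho> \<sigma> z = (\<Sum>j\<le>k. ?R l * ?S l j * nat_basis \<tau> r k j \<gamma> \<delta> z)"
      by (simp only: sum_distrib_left mult.assoc)
  qed
  also have "\<dots> = (\<Sum>j\<le>k. (\<Sum>l = 0..k. ?R l * ?S l j) * nat_basis \<tau> r k j \<gamma> \<delta> z)"
    by (subst sum.swap) (simp add: sum_distrib_right atLeast0AtMost)
  finally show "nat_basis \<tau> r k n \<alpha> \<beta> z
      = (\<Sum>j\<le>k. (\<Sum>l = 0..k. ?R l * ?S l j) * nat_basis \<tau> r k j \<gamma> \<delta> z)" .
qed

end
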